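(* Let $d_0\ge 2$ be an integer, let $a=(2d_0-1)/d_0$, let $c>0$ be a real number, and let $b=p/q$ for coprime integers $p>q>3$. If \[ qa+p-\frac{(q-3)(d_0-1)}{2d_0}<pc, \] then there always exists a convex generator $\Lambda$ such that $\Lambda\le_{P(a,1),E(bc,c)} e_{p,q}^{d_0}$.
   Context: A convex integral path is a path $\Lambda$ in the plane with endpoints $(0,y(\Lambda))$ and $(x(\Lambda),0)$, where $x(\Lambda),y(\Lambda)\ge 0$ are integers, which is the graph of a piecewise linear concave function $f:[0,x(\Lambda)]\to[0,y(\Lambda)]$ with $f'(0)\le 0$, possibly together with a vertical line segment at the right, and all of whose vertices (endpoints and points of slope change) are lattice points; its edges are the segments between consecutive vertices. A convex generator is a convex integral path each of whose edges is labeled "$e$" or "$h$", with horizontal and vertical edges labeled only "$e$". For relatively prime nonnegative integers $r,s$ and a positive integer $m$: $e_{r,s}^m$ denotes an edge with displacement vector $(mr,-ms)$ labeled "$e$"; $h_{r,s}$ denotes an edge with displacement $(r,-s)$ labeled "$h$"; and $e_{r,s}^{m-1}h_{r,s}$ ($m>1$) denotes an edge with displacement $(mr,-ms)$ labeled "$h$". A convex generator is identified with the commutative formal product of these symbols over its edges. $m(\Lambda)$ is the total exponent of all factors in the formal product (one less than the number of lattice points on $\Lambda$); $L(\Lambda)$ is the number of lattice points in the region enclosed by $\Lambda$ and the axes, boundary included; $h(\Lambda)$ is the number of edges labeled "$h$"; the ECH index is $I(\Lambda)=2(L(\Lambda)-1)-h(\Lambda)$. Symplectic actions: for the polydisk $P(a,1)$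 (the toric domain over the rectangle $[0,a]\times[0,1]$), $A_{P(a,1)}(\Lambda)=x(\Lambda)+a\,y(\Lambda)$; for the ellipsoid $E(bc,c)$ (the toric domain over the triangle with vertices $(0,0),(bc,0),(0,c)$), $A_{E(bc,c)}(\Lambda)=\max\{cx+bcy:(x,y)\in\Lambda\}$. For convex generators $\Lambda,\Lambda'$ with all edges of $\Lambda'$ labeled "$e$", one writes $\Lambda\le_{P(a,1),E(bc,c)}\Lambda'$ if: (i) $I(\Lambda)=I(\Lambda')$; (ii) $A_{P(a,1)}(\Lambda)\le A_{E(bc,c)}(\Lambda')$; (iii) $x(\Lambda)+y(\Lambda)-\frac{h(\Lambda)}{2}\ge x(\Lambda')+y(\Lambda')+m(\Lambda')-1$. *)

theory Defs
  imports "HOL-Analysis.Analysis"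
begin

type_synonym point = "real \<times> real"

definition lattice_points :: "point set" where
  "lattice_points = \<int> \<times> \<int>"


subsection \<open>Convex integral paths\<close>

text \<open>A path is represented by its trace, a subset of the plane.\<close>

definition piecewise_linear_on :: "real \<Rightarrow> real \<Rightarrow> (real \<Rightarrow> real) \<Rightarrow> bool" where
  "piecewise_linear_on l r f \<longleftrightarrow>
     (\<exists>T. finite T \<and>
        (\<forall>u v. l \<le> u \<and> u \<le> v \<and> v \<le> r \<and> {u<..<v} \<inter> T = {} \<longrightarrow>
           (\<exists>k n. \<forall>t\<in>{u..v}. f t = k * t + n)))"

text \<open>
  The graph of \<open>f\<close> over \<open>[0, x]\<close>, followed by the vertical segment from \<open>(x, f x)\<close> down
  to \<open>(x, 0)\<close>; that segment degenerates to the endpoint of the graph if \<open>f x = 0\<close>.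
\<close>

definition path_of :: "real \<Rightarrow> (real \<Rightarrow> real) \<Rightarrow> point set" where
  "path_of x f = (\<lambda>t. (t, f t)) ` {0..x} \<union> {x} \<times> {0..f x}"

text \<open>
  The endpoints and the points of slope change of a convex integral path are exactly the points
  of the path around which it is not straight.
\<close>

definition vertices :: "point set \<Rightarrow> point set" where
  "vertices P = {v \<in> P. \<not> (\<exists>s t. v \<in> open_segment s t \<and> closed_segment s t \<subseteq> P)}"

text \<open>
  The condition \<open>f'(0) \<le> 0\<close> is contained in \<open>f 0 = y\<close> and \<open>f t \<le> y\<close>.
\<close>

definition convex_integral_path :: "point set \<Rightarrow> bool" where
  "convex_integral_path P \<longleftrightarrow>
     (\<exists>(x::nat) (y::nat) f.
        f \<in> {0..real x} \<rightarrow> {0..real y} \<and> f 0 = real y \<and>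
        concave_on {0..real x} f \<and> piecewise_linear_on 0 (real x) f \<and>
        P = path_of (real x) f) \<and>
     vertices P \<subseteq> lattice_points"

text \<open>
  An edge is the pair of its endpoints, in the order in which the path runs from
  \<open>(0, y)\<close> to \<open>(x, 0)\<close>. Two vertices are consecutive iff the segment between them lies on
  the path, since a vertex is never in the interior of such a segment.
\<close>

type_synonym edge = "point \<times> point"

definition edges :: "point set \<Rightarrow> edge set" where
  "edges P = {(u, v). u \<in> vertices P \<and> v \<in> vertices P \<and> u \<noteq> v \<and>
     fst u \<le> fst v \<and> snd v \<le> snd u \<and> closed_segment u v \<subseteq> P}"

text \<open>
  The exponent \<open>m\<close> contributed by an edge with displacement \<open>(m r, - m s)\<close>, with \<open>r\<close> and \<open>s\<close>
  relatively prime: it is the total exponent of both \<open>e_{r,s}^m\<close> and \<open>e_{r,s}^{m-1} h_{r,s}\<close>.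
\<close>

definition edge_exponent :: "edge \<Rightarrow> nat" where
  "edge_exponent E = (THE m. \<exists>r s::nat. coprime r s \<and>
     snd E - fst E = (real (m * r), - real (m * s)))"

text \<open>
  The two intercepts. A convex integral path lies in \<open>[0, x] \<times> [0, y]\<close> and contains \<open>(x, 0)\<close>
  and \<open>(0, y)\<close>.
\<close>

definition path_x :: "point set \<Rightarrow> real" where
  "path_x P = Sup (fst ` P)"

definition path_y :: "point set \<Rightarrow> real" where
  "path_y P = Sup (snd ` P)"

definition enclosed_region :: "point set \<Rightarrow> point set" where
  "enclosed_region P = {(u, v). 0 \<le> v \<and> (\<exists>w. v \<le> w \<and> (u, w) \<in> P)}"


subsection \<open>Convex generators\<close>

datatype edge_label = Label_e | Label_h

text \<open>Only the values of \<open>gen_label\<close> on the edges of \<open>gen_path\<close> are relevant.\<close>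

record generator =
  gen_path :: "point set"
  gen_label :: "edge \<Rightarrow> edge_label"

definition convex_generator :: "generator \<Rightarrow> bool" where
  "convex_generator \<Lambda> \<longleftrightarrow> convex_integral_path (gen_path \<Lambda>) \<and>
     (\<forall>(u, v) \<in> edges (gen_path \<Lambda>).
        fst u = fst v \<or> snd u = snd v \<longrightarrow> gen_label \<Lambda> (u, v) = Label_e)"

definition all_e :: "generator \<Rightarrow> bool" where
  "all_e \<Lambda> \<longleftrightarrow> (\<forall>E \<in> edges (gen_path \<Lambda>). gen_label \<Lambda> E = Label_e)"

text \<open>The generator \<open>e_{r,s}^m\<close>, consisting of a single edge.\<close>

definition e_gen :: "nat \<Rightarrow> nat \<Rightarrow> nat \<Rightarrow> generator" where
  "e_gen r s m = \<lparr> gen_path = closed_segment (0, real (m * s)) (real (m * r), 0),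
                   gen_label = (\<lambda>_. Label_e) \<rparr>"

definition m_gen :: "generator \<Rightarrow> nat" where
  "m_gen \<Lambda> = (\<Sum>E \<in> edges (gen_path \<Lambda>). edge_exponent E)"

definition L_gen :: "generator \<Rightarrow> nat" where
  "L_gen \<Lambda> = card (enclosed_region (gen_path \<Lambda>) \<inter> lattice_points)"

definition h_gen :: "generator \<Rightarrow> nat" where
  "h_gen \<Lambda> = card {E \<in> edges (gen_path \<Lambda>). gen_label \<Lambda> E = Label_h}"

definition ECH_index :: "generator \<Rightarrow> int" where
  "ECH_index \<Lambda> = 2 * (int (L_gen \<Lambda>) - 1) - int (h_gen \<Lambda>)"

abbreviation x_gen :: "generator \<Rightarrow> real" where
  "x_gen \<Lambda> \<equiv> path_x (gen_path \<Lambda>)"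

abbreviation y_gen :: "generator \<Rightarrow> real" where
  "y_gen \<Lambda> \<equiv> path_y (gen_path \<Lambda>)"


subsection \<open>Symplectic actions and the order relation\<close>

text \<open>The action for the polydisk \<open>P(a, 1)\<close>.\<close>

definition polydisk_action :: "real \<Rightarrow> generator \<Rightarrow> real" where
  "polydisk_action a \<Lambda> = x_gen \<Lambda> + a * y_gen \<Lambda>"

text \<open>
  The action for the ellipsoid \<open>E(b c, c)\<close>. The supremum is a maximum, as a convex integral
  path is compact.
\<close>

definition ellipsoid_action :: "real \<Rightarrow> real \<Rightarrow> generator \<Rightarrow> real" where
  "ellipsoid_action b c \<Lambda> = (SUP (x, y) \<in> gen_path \<Lambda>. c * x + b * c * y)"

definition gen_le :: "real \<Rightarrow> real \<Rightarrow> real \<Rightarrow> generator \<Rightarrow> generator \<Rightarrow> bool" where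
  "gen_le a b c \<Lambda> \<Lambda>' \<longleftrightarrow>
     convex_generator \<Lambda> \<and> convex_generator \<Lambda>' \<and> all_e \<Lambda>' \<and>
     ECH_index \<Lambda> = ECH_index \<Lambda>' \<and>
     polydisk_action a \<Lambda> \<le> ellipsoid_action b c \<Lambda>' \<and>
     x_gen \<Lambda> + y_gen \<Lambda> - real (h_gen \<Lambda>) / 2
       \<ge> x_gen \<Lambda>' + y_gen \<Lambda>' + real (m_gen \<Lambda>') - 1"

end

theory Submission
  imports Defs
begin

text \<open>
  Write \<open>T\<close> for the number of lattice points enclosed by \<open>e_{p,q}^{d0}\<close>, and look only at
  generators all of whose edges are labeled \<open>e\<close>, with \<open>x + y = d0 (p + q + 1) - 1\<close>, so that
  condition (iii) is an equality. Let \<open>y\<close> be minimal such that the rectangle \<open>[0, x] \<times> [0, y]\<close>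
  contains at least \<open>T\<close> lattice points. By minimality the excess is at most \<open>x\<close>, so it can be
  removed from the right end of the top row: the path from \<open>(0, y)\<close> through \<open>(x - j, y)\<close> and
  \<open>(x, y - 1)\<close> to \<open>(x, 0)\<close> encloses exactly \<open>T\<close> lattice points. As \<open>y = d0 (q + 1) / 2\<close> (rounded
  down) is already large enough, the minimal \<open>y\<close> satisfies \<open>y \<le> d0 (q + 1) / 2\<close>, and this is
  exactly what the action inequality requires under the hypothesis on \<open>c\<close>.
\<close>

subsection \<open>Paths given by graphs\<close>

lemma path_x_path_of:
  assumes "0 \<le> x"
  shows "path_x (path_of x f) = x"
proof -
  have "fst ` path_of x f = {0..x}"
    using assms by (fastforce simp: path_of_def image_Un image_image)
  then show ?thesis
    using assms by (simp add: path_x_def)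
qed

lemma path_y_path_of:
  assumes "0 \<le> x" and "f 0 = y" and "\<And>t. t \<in> {0..x} \<Longrightarrow> f t \<le> y"
  shows "path_y (path_of x f) = y"
  unfolding path_y_def
proof (rule cSup_eq_maximum)
  have "(0, f 0) \<in> path_of x f"
    using assms(1) by (auto simp: path_of_def)
  then show "y \<in> snd ` path_of x f"
    using assms(2) by (metis image_eqI snd_conv)
next
  fix v assume "v \<in> snd ` path_of x f"
  then consider t where "t \<in> {0..x}" "v = f t" | "v \<le> f x"
    by (auto simp: path_of_def)
  then show "v \<le> y"
    using assms(1) assms(3)[of x] by cases (use assms(3) in force)+
qed

lemma enclosed_region_path_of:
  assumes "0 \<le> x"
  shows "enclosed_region (path_of x f) = {(u, v). 0 \<le> u \<and> u \<le> x \<and> 0 \<le> v \<and> v \<le> f u}"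
  using assms by (force simp: enclosed_region_def path_of_def)

text \<open>Moves the count behind \<open>L_gen\<close> to pairs of naturals, where both generators
  can be counted by finite set arithmetic.\<close>

lemma card_enclosed_region_path_of:
  "card (enclosed_region (path_of (real x) f) \<inter> lattice_points) =
    card {(i::nat, k::nat). i \<le> x \<and> real k \<le> f (real i)}"
proof -
  let ?g = "\<lambda>(i::nat, k::nat). (real i, real k)"
  have "enclosed_region (path_of (real x) f) \<inter> lattice_points =
    ?g ` {(i, k). i \<le> x \<and> real k \<le> f (real i)}" (is "?A = ?B")
  proof
    show "?A \<subseteq> ?B"
    proof (clarsimp simp: enclosed_region_path_of lattice_points_def)
      fix u v :: real
      assume *: "u \<in> \<int>" "v \<in> \<int>" "0 \<le> u" "u \<le> real x" "0 \<le> v" "v \<le> f u"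
      then obtain i k :: nat where "u = real i" "v = real k"
        by (metis Nats_altdef2 Nats_cases mem_Collect_eq)
      with * show "(u, v) \<in> ?B"
        by force
    qed
    show "?B \<subseteq> ?A"
      by (auto simp: enclosed_region_path_of lattice_points_def)
  qed
  moreover have "inj ?g"
    by (auto simp: inj_def)
  ultimately show ?thesis
    by (simp add: card_image inj_on_subset)
qed

lemma convex_integral_path_path_of:
  fixes x y :: nat
  assumes "\<And>t. t \<in> {0..real x} \<Longrightarrow> 0 \<le> f t \<and> f t \<le> real y" and "f 0 = real y"
    and "concave_on {0..real x} f" and "piecewise_linear_on 0 (real x) f"
    and "vertices (path_of (real x) f) \<subseteq> lattice_points"
  shows "convex_integral_path (path_of (real x) f)"
  unfolding convex_integral_path_def using assms by (intro conjI exI[of _ x] exI[of _ y] exI[of _ f]) auto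

lemma concave_on_affine:
  fixes S :: "real set"
  assumes "convex S"
  shows "concave_on S (\<lambda>t. k * t + n)"
  unfolding concave_on_iff
proof (intro conjI ballI allI impI)
  fix s t u v :: real
  assume "u + v = 1"
  then have "n = u * n + v * n"
    by (metis distrib_right mult_1)
  then show "u * (k * s + n) + v * (k * t + n) \<le> k * (u *\<^sub>R s + v *\<^sub>R t) + n"
    by (simp add: algebra_simps)
qed (fact assms)

text \<open>Intended for \<open>cut_top\<close>, a minimum of two affine functions.\<close>

lemma concave_on_min:
  assumes "concave_on S f" and "concave_on S g"
  shows "concave_on S (\<lambda>t. min (f t) (g t))"
  unfolding concave_on_iff
proof (intro conjI ballI allI impI)
  show "convex S"
    using assms concave_on_imp_convex by blast
  fix s t and u v :: real
  assume "s \<in> S" "t \<in> S" "0 \<le> u" "0 \<le> v" "u + v = 1"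
  then have "u * f s + v * f t \<le> f (u *\<^sub>R s + v *\<^sub>R t)"
    "u * g s + v * g t \<le> g (u *\<^sub>R s + v *\<^sub>R t)"
    "u * min (f s) (g s) \<le> u * f s" "u * min (f s) (g s) \<le> u * g s"
    "v * min (f t) (g t) \<le> v * f t" "v * min (f t) (g t) \<le> v * g t"
    using assms by (auto simp: concave_on_iff intro: mult_left_mono)
  then show "u * min (f s) (g s) + v * min (f t) (g t)
      \<le> min (f (u *\<^sub>R s + v *\<^sub>R t)) (g (u *\<^sub>R s + v *\<^sub>R t))"
    by linarith
qed

lemma graph_of_affine_eq_segment:
  assumes "u \<le> (v::real)"
  shows "(\<lambda>t. (t, k * t + n)) ` {u..v} = closed_segment (u, k * u + n) (v, k * v + n)"
proof -
  have "linear (\<lambda>t::real. (t, k * t))"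
    by (rule linearI) (auto simp: algebra_simps)
  from closed_segment_linear_image[OF this, of u v]
  have "closed_segment (u, k * u) (v, k * v) = (\<lambda>t. (t, k * t)) ` {u..v}"
    using assms by (simp add: closed_segment_eq_real_ivl)
  then show ?thesis
    using closed_segment_translation[of "(0, n)" "(u, k * u)" "(v, k * v)"]
    by (simp add: image_image add.commute)
qed

text \<open>The graph over an interval where \<open>f\<close> is affine is a segment on the path,
  and \<open>t\<close> lies strictly inside. Only breakpoints and ends thus remain as candidates for
  vertices, so integrality can be checked without determining the vertex set.\<close>

lemma not_vertex_affine:
  assumes "0 \<le> u" and "u < t" and "t < v" and "v \<le> x"
    and "\<And>t. t \<in> {u..v} \<Longrightarrow> f t = k * t + n"
  shows "(t, f t) \<notin> vertices (path_of x f)"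
proof -
  have "closed_segment (u, k * u + n) (v, k * v + n) = (\<lambda>t. (t, k * t + n)) ` {u..v}"
    using assms by (intro graph_of_affine_eq_segment[symmetric]) auto
  also have "\<dots> = (\<lambda>t. (t, f t)) ` {u..v}"
    using assms(5) by (intro image_cong) auto
  finally have eq: "closed_segment (u, k * u + n) (v, k * v + n) = (\<lambda>t. (t, f t)) ` {u..v}" .
  have "(\<lambda>t. (t, f t)) ` {u..v} \<subseteq> (\<lambda>t. (t, f t)) ` {0..x}"
    using assms by (intro image_mono) auto
  then have "closed_segment (u, k * u + n) (v, k * v + n) \<subseteq> path_of x f"
    unfolding eq path_of_def by (rule le_supI1)
  moreover have "(t, f t) \<in> open_segment (u, k * u + n) (v, k * v + n)"
    unfolding open_segment_def eq using assms by auto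
  ultimately show ?thesis
    unfolding vertices_def by blast
qed

lemma not_vertex_vertical:
  assumes "0 < s" and "s < f x"
  shows "(x, s) \<notin> vertices (path_of x f)"
proof -
  have "(x, s) = (1 - s / f x) *\<^sub>R (x, 0) + (s / f x) *\<^sub>R (x, f x)"
    using assms by (simp add: algebra_simps)
  moreover have "0 < s / f x" and "s / f x < 1"
    using assms by auto
  ultimately have "(x, s) \<in> open_segment (x, 0) (x, f x)"
    unfolding in_segment using assms by (intro conjI exI[of _ "s / f x"]) auto
  moreover have "closed_segment (x, 0) (x, f x) \<subseteq> {x} \<times> {0..f x}"
  proof clarify
    fix u v assume "(u, v) \<in> closed_segment (x, 0) (x, f x)"
    from closed_segment_PairD[OF this] show "u \<in> {x} \<and> v \<in> {0..f x}"
      using assms by (simp add: closed_segment_eq_real_ivl)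
  qed
  then have "closed_segment (x, 0) (x, f x) \<subseteq> path_of x f"
    unfolding path_of_def by (rule le_supI2)
  ultimately show ?thesis
    unfolding vertices_def by blast
qed

subsection \<open>A rectangle with a shortened top row\<close>

text \<open>
  For \<open>j = 0\<close> the division by \<open>j\<close> yields \<open>0\<close>, and the function is the constant \<open>y\<close>, as desired.
\<close>

definition cut_top :: "nat \<Rightarrow> nat \<Rightarrow> nat \<Rightarrow> real \<Rightarrow> real" where
  "cut_top m j y t = min (real y) (real y - (t - real m) / real j)"

lemma cut_top_left: "t \<le> real m \<Longrightarrow> cut_top m j y t = real y"
  by (auto simp: cut_top_def divide_nonpos_nonneg min_def)

lemma cut_top_right:
  "real m \<le> t \<Longrightarrow> cut_top m j y t = real y - (t - real m) / real j"
  by (simp add: cut_top_def)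

text \<open>The sloped edge has slope \<open>-1/j\<close> and horizontal length \<open>j\<close>, so
  the total drop is at most 1.\<close>

lemma cut_top_bounds:
  assumes "t \<le> real (m + j)" and "1 \<le> y"
  shows "real y - 1 \<le> cut_top m j y t" and "cut_top m j y t \<le> real y"
proof -
  have "(t - real m) / real j \<le> 1"
    using assms by (cases "j = 0") (auto simp: divide_simps)
  then show "real y - 1 \<le> cut_top m j y t"
    by (simp add: cut_top_def)
qed (simp add: cut_top_def)

text \<open>Both values are integers, so the upper end of the vertical edge is a lattice
  point.\<close>

lemma cut_top_end:
  "cut_top m j y (real (m + j)) = real y - (if j = 0 then 0 else 1)"
  by (simp add: cut_top_def)

lemma concave_on_cut_top: "convex S \<Longrightarrow> concave_on S (cut_top m j y)"
proof -
  assume S: "convex S"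
  have "cut_top m j y =
    (\<lambda>t. min (0 * t + real y) ((- 1 / real j) * t + (real y + real m / real j)))"
    by (auto simp: cut_top_def fun_eq_iff diff_divide_distrib)
  then show ?thesis
    by (simp only: concave_on_min[OF concave_on_affine[OF S] concave_on_affine[OF S]])
qed

lemma cut_top_right_affine:
  "real m \<le> t \<Longrightarrow> cut_top m j y t = (- 1 / real j) * t + (real y + real m / real j)"
  by (simp add: cut_top_right diff_divide_distrib)

lemma piecewise_linear_on_cut_top: "piecewise_linear_on l r (cut_top m j y)"
  unfolding piecewise_linear_on_def
proof (intro exI[of _ "{real m}"] conjI allI impI)
  fix u v :: real
  assume "l \<le> u \<and> u \<le> v \<and> v \<le> r \<and> {u<..<v} \<inter> {real m} = {}"
  then consider "v \<le> real m" | "real m \<le> u"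
    by force
  then show "\<exists>k n. \<forall>t\<in>{u..v}. cut_top m j y t = k * t + n"
  proof cases
    case 1
    then show ?thesis
      by (intro exI[of _ 0] exI[of _ "real y"]) (auto simp: cut_top_left)
  next
    case 2
    then show ?thesis
      by (intro exI[of _ "- 1 / real j"] exI[of _ "real y + real m / real j"])
        (use cut_top_right_affine in auto)
  qed
qed simp

lemma vertices_cut_top:
  assumes "1 \<le> y"
  shows "vertices (path_of (real (m + j)) (cut_top m j y)) \<subseteq> lattice_points"
proof
  let ?x = "real (m + j)" and ?f = "cut_top m j y"
  fix w assume w: "w \<in> vertices (path_of ?x ?f)"
  then have "w \<in> path_of ?x ?f"
    by (simp add: vertices_def)
  then consider t where "w = (t, ?f t)" "0 \<le> t" "t \<le> ?x"
    | s where "w = (?x, s)" "0 \<le> s" "s \<le> ?f ?x"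
    by (auto simp: path_of_def)
  then show "w \<in> lattice_points"
  proof cases
    case 1
    have "\<not> (0 < t \<and> t < real m)"
      using w not_vertex_affine[of 0 t "real m" ?x ?f 0 "real y"] 1 by (auto simp: cut_top_left)
    moreover have "\<not> (real m < t \<and> t < ?x)"
      using w 1(1) not_vertex_affine[of "real m" t ?x ?x ?f "- 1 / real j" "real y + real m / real j"]
        cut_top_right_affine[of m _ j y] by (meson atLeastAtMost_iff of_nat_0_le_iff order_refl)
    ultimately have "t = 0 \<or> t = real m \<or> t = ?x"
      using 1 by linarith
    then show ?thesis
      using 1 cut_top_end[of m j y] by (auto simp: lattice_points_def cut_top_left)
  next
    case 2
    have "\<not> (0 < s \<and> s < ?f ?x)"
      using w 2(1) not_vertex_vertical[of s ?f ?x] by blast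
    then have "s = 0 \<or> s = ?f ?x"
      using 2 by linarith
    then show ?thesis
      using 2 cut_top_end[of m j y] by (auto simp: lattice_points_def)
  qed
qed

lemma convex_integral_path_cut_top:
  assumes "1 \<le> y"
  shows "convex_integral_path (path_of (real (m + j)) (cut_top m j y))"
proof (rule convex_integral_path_path_of)
  fix t assume "t \<in> {0..real (m + j)}"
  then show "0 \<le> cut_top m j y t \<and> cut_top m j y t \<le> real y"
    using cut_top_bounds[of t m j y] assms by auto
qed (use assms in \<open>auto simp: cut_top_left concave_on_cut_top piecewise_linear_on_cut_top
      vertices_cut_top[simplified]\<close>)

text \<open>Each of the \<open>j\<close> columns to the right of \<open>m\<close> loses its point at
  height \<open>y\<close> and no other, because the graph stays between \<open>y - 1\<close> and
  \<open>y\<close>. The lost points form \<open>?C\<close>.\<close>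

lemma card_under_cut_top:
  assumes "1 \<le> y"
  shows "card {(i::nat, k::nat). i \<le> m + j \<and> real k \<le> cut_top m j y (real i)} + j
    = (m + j + 1) * (y + 1)"
proof -
  let ?A = "{(i::nat, k::nat). i \<le> m + j \<and> real k \<le> cut_top m j y (real i)}"
  let ?C = "{m<..m + j} \<times> {y}"
  have "real k \<le> cut_top m j y (real i) \<longleftrightarrow> k \<le> y \<and> \<not> (m < i \<and> k = y)" if "i \<le> m + j" for i k
  proof (cases "i \<le> m")
    case True
    then show ?thesis by (simp add: cut_top_left)
  next
    case False
    \<comment> \<open>Here \<open>m < i\<close> and \<open>i \<le> m + j\<close> force
      \<open>j > 0\<close>, so the division is genuine and the drop is strict.\<close>
    then have "cut_top m j y (real i) < real y"
      using that by (simp add: cut_top_right)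
    moreover have "real y - 1 \<le> cut_top m j y (real i)"
      using cut_top_bounds(1)[of "real i" m j y] that assms by simp
    ultimately show ?thesis
      using False by (cases "k < y") auto
  qed
  then have union: "?A \<union> ?C = {..m + j} \<times> {..y}" and "?A \<inter> ?C = {}"
    by auto
  moreover have "finite (?A \<union> ?C)"
    unfolding union by simp
  then have "finite ?A"
    by (rule finite_subset[OF Un_upper1])
  ultimately show ?thesis
    using card_Un_disjoint[of ?A ?C] by (simp add: card_cartesian_product)
qed

subsection \<open>The generator \<open>e_{p,q}^d\<close>\<close>

text \<open>A segment lies in a convex set as soon as its endpoints do, so for this path vertices
  are the same as extreme points.\<close>

lemma vertices_closed_segment: "vertices (closed_segment u v) = {u, v}"
proof -
  have "w \<in> vertices (closed_segment u v) \<longleftrightarrow> w extreme_point_of closed_segment u v" for w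
    unfolding vertices_def extreme_point_of_def
    by (auto simp: subset_closed_segment)
  then show ?thesis
    by (auto simp: extreme_point_of_segment)
qed

lemma edges_closed_segment:
  assumes "fst u \<le> fst v" and "snd v \<le> snd u" and "u \<noteq> v"
  shows "edges (closed_segment u v) = {(u, v)}"
  using assms by (auto simp: edges_def vertices_closed_segment prod_eq_iff)

text \<open>In any factorization with coprime \<open>r\<close> and \<open>s\<close>, the factor
  \<open>m\<close> is the gcd of the two displacement coordinates; this gives the uniqueness
  required by \<open>THE\<close>.\<close>

lemma edge_exponent_eq:
  assumes "coprime p q" and "0 < p"
  shows "edge_exponent ((0, real (d * q)), (real (d * p), 0)) = d"
  unfolding edge_exponent_def
proof (rule the_equality)
  show "\<exists>r s. coprime r s \<and> snd ((0, real (d * q)), (real (d * p), 0))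
      - fst ((0, real (d * q)), (real (d * p), 0)) = (real (d * r), - real (d * s))"
    using assms by (intro exI[of _ p] exI[of _ q]) simp
next
  fix m
  assume "\<exists>r s. coprime r s \<and> snd ((0, real (d * q)), (real (d * p), 0))
      - fst ((0, real (d * q)), (real (d * p), 0)) = (real (m * r), - real (m * s))"
  then obtain r s where rs: "coprime r s"
    "real (d * p) = real (m * r)" "real (d * q) = real (m * s)"
    by auto
  then have "gcd (d * p) (d * q) = gcd (m * r) (m * s)"
    using of_nat_eq_iff by metis
  then show "m = d"
    using rs(1) assms(1) by (simp add: gcd_mult_distrib_nat[symmetric])
qed

text \<open>The affine function vanishes at \<open>x\<close>, so the vertical part of
  \<open>path_of\<close> shrinks to a point already on the graph.\<close>

lemma closed_segment_eq_path_of: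
  assumes "0 < x"
  shows "closed_segment (0, y) (x, 0) = path_of x (\<lambda>t. (- y / x) * t + y)"
  using graph_of_affine_eq_segment[of 0 x "- y / x" y] assms
  by (auto simp: path_of_def)

lemma coprime_mult_eq_multE:
  fixes d p q :: nat
  assumes "coprime p q" and "0 < p" and "i * q = k * p"
  obtains n where "i = n * p" and "k = n * q"
proof -
  have "p dvd i * q"
    using assms(3) by simp
  then have "p dvd i"
    using assms(1) by (simp add: coprime_dvd_mult_left_iff)
  then obtain n where "i = n * p"
    by (metis dvd_def mult.commute)
  with assms that show ?thesis
    by auto
qed

text \<open>
  Central symmetry of the rectangle exchanges the two closed triangles cut off by the diagonal,
  which contains \<open>d + 1\<close> lattice points.
\<close>

lemma card_triangle:
  fixes d p q :: nat
  assumes "coprime p q" and "0 < p" and "0 < q"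
  shows "2 * card {(i, k). i \<le> d * p \<and> i * q + k * p \<le> d * p * q}
    = (d * p + 1) * (d * q + 1) + d + 1"
proof -
  let ?A = "{(i, k). i \<le> d * p \<and> i * q + k * p \<le> d * p * q}"
  let ?B = "{(i, k). i \<le> d * p \<and> k \<le> d * q \<and> d * p * q \<le> i * q + k * p}"
  let ?g = "\<lambda>(i, k). (d * p - i, d * q - k)"
  \<comment> \<open>By coprimality, successive lattice points on the diagonal differ by
    \<open>(p, -q)\<close>.\<close>
  let ?D = "(\<lambda>n. (n * p, (d - n) * q)) ` {..d}"
  \<comment> \<open>This bound, implicit in \<open>?A\<close>, keeps the truncated subtraction in
    \<open>?g\<close> exact.\<close>
  have k_le: "k \<le> d * q" if "i * q + k * p \<le> d * p * q" for i k
  proof -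
    have "k * p \<le> i * q + k * p"
      by simp
    also have "\<dots> \<le> (d * q) * p"
      using that by (simp only: ac_simps)
    finally show ?thesis
      using assms(2) mult_le_cancel2 by blast
  qed
  \<comment> \<open>A point and its mirror image have values of \<open>i * q + k * p\<close> that
    average to \<open>d * p * q\<close>, so the reflection reverses the defining inequality.\<close>
  have symmetric: "(d * p - i) * q + (d * q - k) * p + (i * q + k * p) = 2 * (d * p * q)"
    if i: "i \<le> d * p" and k: "k \<le> d * q" for i k
  proof -
    obtain i' where i': "d * p = i + i'"
      using i le_Suc_ex by blast
    obtain k' where k': "d * q = k + k'"
      using k le_Suc_ex by blast
    from i' k' have "(d * p - i) * q + (d * q - k) * p + (i * q + k * p) = (i + i') * q + (k + k') * p"
      by (simp add: algebra_simps)
    also have "\<dots> = (d * p) * q + (d * q) * p"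
      by (simp only: i' k')
    also have "\<dots> = 2 * (d * p * q)"
      by simp
    finally show ?thesis .
  qed
  have "bij_betw ?g ?A ?B"
  proof (rule bij_betw_byWitness[where f' = ?g])
    show "\<forall>z\<in>?A. ?g (?g z) = z" "\<forall>z\<in>?B. ?g (?g z) = z"
      using k_le by auto
    show "?g ` ?A \<subseteq> ?B"
    proof (rule image_subsetI, clarify)
      fix i k
      assume ik: "i \<le> d * p" "i * q + k * p \<le> d * p * q"
      then have "d * p * q \<le> (d * p - i) * q + (d * q - k) * p"
        using symmetric[OF ik(1) k_le[OF ik(2)]] by linarith
      then show "d * p - i \<le> d * p \<and> d * q - k \<le> d * q \<and>
          d * p * q \<le> (d * p - i) * q + (d * q - k) * p"
        by simp
    qed
    show "?g ` ?B \<subseteq> ?A"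
    proof (rule image_subsetI, clarify)
      fix i k
      assume ik: "i \<le> d * p" "k \<le> d * q" "d * p * q \<le> i * q + k * p"
      then have "(d * p - i) * q + (d * q - k) * p \<le> d * p * q"
        using symmetric[OF ik(1,2)] by linarith
      then show "d * p - i \<le> d * p \<and> (d * p - i) * q + (d * q - k) * p \<le> d * p * q"
        by simp
    qed
  qed
  then have "card ?A = card ?B"
    by (rule bij_betw_same_card)
  moreover have union: "?A \<union> ?B = {..d * p} \<times> {..d * q}"
    using k_le by auto
  moreover have "?A \<inter> ?B = ?D"
  proof
    show "?A \<inter> ?B \<subseteq> ?D"
    proof (rule subrelI)
      fix i k
      assume "(i, k) \<in> ?A \<inter> ?B"
      then have "i \<le> d * p" "k \<le> d * q" "i * q + k * p = d * p * q"
        by auto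
      then have "i * q = (d * q - k) * p"
        by (simp add: algebra_simps)
      then obtain n where n: "i = n * p" "d * q - k = n * q"
        using coprime_mult_eq_multE assms by metis
      then have "n \<le> d"
        using \<open>i \<le> d * p\<close> assms by simp
      moreover have "k = (d - n) * q"
        using n \<open>k \<le> d * q\<close> by (simp add: diff_mult_distrib)
      ultimately show "(i, k) \<in> ?D"
        using n by auto
    qed
    show "?D \<subseteq> ?A \<inter> ?B"
    proof (rule image_subsetI)
      fix n assume "n \<in> {..d}"
      then have "n \<le> d"
        by simp
      then obtain e where "d = n + e"
        using le_Suc_ex by blast
      then have "n * p * q + (d - n) * q * p = d * p * q"
        by (simp add: algebra_simps)
      then show "(n * p, (d - n) * q) \<in> ?A \<inter> ?B"
        using \<open>n \<le> d\<close> by simp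
    qed
  qed
  moreover have "card ?D = d + 1"
    using assms by (subst card_image) (auto simp: inj_on_def)
  moreover have "finite (?A \<union> ?B)"
    unfolding union by simp
  then have "finite ?A" and "finite ?B"
    by (rule finite_subset[OF Un_upper1], rule finite_subset[OF Un_upper2])
  ultimately show ?thesis
    using card_Un_Int[of ?A ?B] by (simp add: card_cartesian_product)
qed

section \<open>Invariants of the single-edge generator\<close>

context
  fixes d p q :: nat
  assumes d: "0 < d" and p: "0 < p" and q: "0 < q" and coprime: "coprime p q"
begin

private abbreviation "line \<equiv> (\<lambda>t. (- real (d * q) / real (d * p)) * t + real (d * q))"

lemma gen_path_e_gen: "gen_path (e_gen p q d) = path_of (real (d * p)) line"
  unfolding e_gen_def generator.simps
  by (rule closed_segment_eq_path_of) (use d p in simp)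

lemma le_line_iff:
  "v \<le> line u \<longleftrightarrow> u * real q + v * real p \<le> real (d * p * q)"
  using d p by (simp add: field_simps)

lemma line_bounds:
  assumes "t \<in> {0..real (d * p)}"
  shows "0 \<le> line t \<and> line t \<le> real (d * q)"
proof
  have "t * real q \<le> real (d * p) * real q"
    using assms by (intro mult_right_mono) auto
  then show "0 \<le> line t"
    unfolding le_line_iff by simp
  show "line t \<le> real (d * q)"
    using assms by (simp add: divide_nonneg_nonneg)
qed

lemma edges_e_gen:
  "edges (gen_path (e_gen p q d)) = {((0, real (d * q)), (real (d * p), 0))}"
  unfolding e_gen_def generator.simps
  by (rule edges_closed_segment) (use d p in auto)

lemma convex_generator_e_gen: "convex_generator (e_gen p q d)"
proof -
  have "vertices (gen_path (e_gen p q d)) \<subseteq> lattice_points"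
    by (simp add: e_gen_def vertices_closed_segment lattice_points_def)
  moreover have "piecewise_linear_on 0 (real (d * p)) line"
    unfolding piecewise_linear_on_def by (rule exI[of _ "{}"]) blast
  moreover have "concave_on {0..real (d * p)} line"
    by (rule concave_on_affine) simp
  moreover have "line 0 = real (d * q)"
    by simp
  ultimately have "convex_integral_path (gen_path (e_gen p q d))"
    unfolding gen_path_e_gen using line_bounds
    by (intro convex_integral_path_path_of[where y = "d * q"])
  then show ?thesis
    by (auto simp: convex_generator_def) (simp_all add: e_gen_def)
qed

lemma all_e_e_gen: "all_e (e_gen p q d)"
  by (simp add: all_e_def e_gen_def)

lemma h_gen_e_gen: "h_gen (e_gen p q d) = 0"
  by (simp add: h_gen_def e_gen_def)

lemma m_gen_e_gen: "m_gen (e_gen p q d) = d"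
  unfolding m_gen_def edges_e_gen using edge_exponent_eq[OF coprime p] by simp

lemma x_gen_e_gen: "x_gen (e_gen p q d) = real (d * p)"
  unfolding gen_path_e_gen by (rule path_x_path_of) simp

lemma y_gen_e_gen: "y_gen (e_gen p q d) = real (d * q)"
  unfolding gen_path_e_gen by (rule path_y_path_of) (use line_bounds in auto)

lemma L_gen_e_gen: "2 * L_gen (e_gen p q d) = (d * p + 1) * (d * q + 1) + d + 1"
proof -
  have "real k \<le> line (real i) \<longleftrightarrow> i * q + k * p \<le> d * p * q" for i k :: nat
    unfolding le_line_iff by (metis of_nat_add of_nat_le_iff of_nat_mult)
  then have "L_gen (e_gen p q d) = card {(i, k). i \<le> d * p \<and> i * q + k * p \<le> d * p * q}"
    unfolding L_gen_def gen_path_e_gen card_enclosed_region_path_of by simp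
  then show ?thesis
    using card_triangle[OF coprime p q] by simp
qed

text \<open>The edge is parallel to the hypotenuse of the triangle defining the ellipsoid, so the
  functional is constant on it and the supremum is over a singleton.\<close>

lemma ellipsoid_action_e_gen:
  assumes "b = real p / real q"
  shows "ellipsoid_action b c (e_gen p q d) = c * real (d * p)"
proof -
  have "c * u + b * c * v = c * real (d * p)" if uv: "(u, v) \<in> gen_path (e_gen p q d)" for u v
  proof -
    obtain s where s: "u = s * real (d * p)" "v = (1 - s) * real (d * q)"
      using uv by (auto simp: e_gen_def closed_segment_def)
    have "c * u + b * c * v = c * s * real d * real p + c * (1 - s) * real d * (b * real q)"
      by (simp add: s)
    also have "b * real q = real p"
      using q assms by simp
    finally show ?thesis
      by (simp add: algebra_simps)
  qed
  then have "(\<lambda>(u, v). c * u + b * c * v) ` gen_path (e_gen p q d) = {c * real (d * p)}"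
    by (force simp: e_gen_def)
  then show ?thesis
    by (simp add: ellipsoid_action_def)
qed

end

subsection \<open>The choice of the rectangle\<close>

lemma ex_minimal_rectangle:
  fixes N T Y :: nat
  assumes "N + 1 < T" and "Y \<le> N" and "T \<le> (N - Y + 1) * (Y + 1)"
  obtains x y j where "x + y = N" and "1 \<le> y" and "y \<le> Y" and "j \<le> x"
    and "(x + 1) * (y + 1) = T + j"
proof -
  define P where "P y \<longleftrightarrow> T \<le> (N - y + 1) * (y + 1)" for y
  define y where "y = (LEAST y. P y)"
  have "P Y"
    using assms by (simp add: P_def)
  then have y: "P y" "y \<le> Y"
    unfolding y_def by (auto intro: LeastI Least_le)
  \<comment> \<open>Height 0 gives only \<open>N + 1\<close> points; hence \<open>y\<close> has a
    predecessor to which minimality applies.\<close>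
  moreover have "\<not> P 0"
    using assms by (simp add: P_def)
  ultimately have "1 \<le> y"
    by (metis One_nat_def Suc_leI gr0I)
  then obtain z where z: "y = Suc z"
    by (metis Suc_le_D One_nat_def)
  then have "\<not> P z"
    unfolding y_def by (metis lessI not_less_Least)
  define x where "x = N - y"
  have N: "N = x + y"
    using y(2) assms(2) by (simp add: x_def)
  \<comment> \<open>The second inequality is the failure at height \<open>y - 1\<close> and width
    \<open>x + 1\<close>. Together they bound the excess \<open>(x + 1) * (y + 1) - T\<close> by
    \<open>x - y\<close>, hence by \<open>x\<close>.\<close>
  have "T \<le> (x + 1) * (y + 1)" "(x + 2) * y < T"
    using y(1) \<open>\<not> P z\<close> N z by (auto simp: P_def)
  then show thesis
    using that[of x y "(x + 1) * (y + 1) - T"] N \<open>1 \<le> y\<close> y(2) by (simp add: algebra_simps)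
qed

text \<open>Doubling both side counts removes the rounding in \<open>Y\<close>: they are at least
  \<open>d * (2 * p + q + 1)\<close> and \<open>d * (q + 1) + 1\<close> for either parity. The
  product is then compared with \<open>4 * T\<close>.\<close>

lemma rectangle_large_enough:
  fixes d p q T Y :: nat
  assumes "2 \<le> d" and "3 < q" and "q < p"
    and T: "2 * T = (d * p + 1) * (d * q + 1) + d + 1"
    and Y: "Y = d * (q + 1) div 2"
  defines "N \<equiv> d * (p + q + 1) - 1"
  shows "N + 1 < T" and "Y \<le> N" and "T \<le> (N - Y + 1) * (Y + 1)"
proof -
  have N: "N + 1 = d * (p + q + 1)"
    using assms by (simp add: N_def)
  have Y2: "2 * Y \<le> d * (q + 1)" "d * (q + 1) \<le> 2 * Y + 1"
    unfolding Y by auto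
  show "Y \<le> N"
    using Y2 N assms by (simp add: algebra_simps)
  have pq: "p + q + 1 \<le> p * q"
  proof -
    have "p * 4 \<le> p * q"
      using assms by simp
    then show ?thesis
      using assms by linarith
  qed
  \<comment> \<open>The left side is \<open>2 * (N + 1)\<close>, the right side the leading term of
    \<open>2 * T\<close>.\<close>
  have "d * 2 * (p + q + 1) \<le> d * d * (p * q)"
    using pq assms by (intro mult_mono) auto
  then show "N + 1 < T"
    unfolding N using T by (simp add: algebra_simps)
  have "d * (2 * p + q + 1) \<le> 2 * (N - Y + 1)"
    using N Y2(1) \<open>Y \<le> N\<close> by (simp add: algebra_simps)
  moreover have "d * (q + 1) + 1 \<le> 2 * (Y + 1)"
    using Y2(2) by simp
  ultimately have "(d * (2 * p + q + 1)) * (d * (q + 1) + 1) \<le> (2 * (N - Y + 1)) * (2 * (Y + 1))"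
    by (rule mult_mono) auto
  moreover have "2 * (2 * T) \<le> (d * (2 * p + q + 1)) * (d * (q + 1) + 1)"
  proof -
    \<comment> \<open>After expansion \<open>2 * d * d * p * q\<close> cancels; this bound and the
      next absorb the remaining \<open>2 * d * (p + q + 1) + 4\<close> of
      \<open>4 * T\<close>.\<close>
    have "d * 2 * (p + q + 1) \<le> d * d * (2 * p + (q + 1) * (q + 1))"
      using assms by (intro mult_mono) auto
    moreover have "2 * 1 \<le> d * p"
      using assms by (intro mult_mono) auto
    ultimately show ?thesis
      unfolding T using assms(1) by (simp add: algebra_simps)
  qed
  ultimately show "T \<le> (N - Y + 1) * (Y + 1)"
    by (simp add: algebra_simps)
qed

section \<open>The generator and the three conditions of the order relation\<close>

theorem proposition3p6:
  fixes d0 p q :: nat and a b c :: real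
  assumes "d0 \<ge> 2"
    and "a = (2 * real d0 - 1) / real d0"
    and "c > 0"
    and "coprime p q" and "p > q" and "q > 3"
    and "b = real p / real q"
    and "real q * a + real p - (real q - 3) * (real d0 - 1) / (2 * real d0) < real p * c"
  shows "\<exists>\<Lambda>. convex_generator \<Lambda> \<and> gen_le a b c \<Lambda> (e_gen p q d0)"
proof -
  let ?E = "e_gen p q d0"
  note e_gen = convex_generator_e_gen all_e_e_gen h_gen_e_gen m_gen_e_gen x_gen_e_gen
    y_gen_e_gen L_gen_e_gen ellipsoid_action_e_gen
  have pos: "0 < d0" "0 < p" "0 < q"
    using assms by auto
  note E = e_gen[OF pos assms(4)]
  obtain x y j where xy: "x + y = d0 * (p + q + 1) - 1" "1 \<le> y" "y \<le> d0 * (q + 1) div 2" "j \<le> x"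
    "(x + 1) * (y + 1) = L_gen ?E + j"
    using ex_minimal_rectangle
      rectangle_large_enough[OF assms(1) \<open>q > 3\<close> \<open>p > q\<close> L_gen_e_gen[OF pos assms(4)] refl] by metis
  define m where "m = x - j"
  have x: "x = m + j"
    using xy(4) by (simp add: m_def)
  define \<Lambda> where "\<Lambda> = \<lparr>gen_path = path_of (real x) (cut_top m j y), gen_label = \<lambda>_. Label_e\<rparr>"
  have "convex_generator \<Lambda>"
    using convex_integral_path_cut_top[OF xy(2), of m j]
    by (simp add: convex_generator_def \<Lambda>_def x)
  moreover have h: "h_gen \<Lambda> = 0"
    by (simp add: h_gen_def \<Lambda>_def)
  moreover have "L_gen \<Lambda> = L_gen ?E"
  proof -
    have "L_gen \<Lambda> + j = (x + 1) * (y + 1)"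
      unfolding L_gen_def \<Lambda>_def generator.simps card_enclosed_region_path_of x
      by (rule card_under_cut_top[OF xy(2)])
    then show ?thesis
      using xy(5) by simp
  qed
  moreover have xg: "x_gen \<Lambda> = real x"
    by (simp add: \<Lambda>_def path_x_path_of)
  moreover have yg: "y_gen \<Lambda> = real y"
    unfolding \<Lambda>_def generator.simps
    by (rule path_y_path_of) (use cut_top_bounds(2)[of _ m j y] xy(2) x in \<open>auto simp: cut_top_left\<close>)
  moreover have sum: "real x + real y = real d0 * (real p + real q + 1) - 1"
  proof -
    have "x + y + 1 = d0 * (p + q + 1)"
      using xy(1) pos by simp
    then have "real (x + y + 1) = real (d0 * (p + q + 1))"
      by (rule arg_cong)
    then show ?thesis
      by (simp add: algebra_simps)
  qed
  moreover have "polydisk_action a \<Lambda> \<le> ellipsoid_action b c ?E"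
  proof -
    have "2 * y \<le> d0 * (q + 1)"
      using xy(3) by linarith
    then have "2 * real y \<le> real d0 * (real q + 1)"
      by (metis of_nat_1 of_nat_add of_nat_le_iff of_nat_mult of_nat_numeral)
    then have "(real d0 - 1) * (2 * real y) \<le> (real d0 - 1) * (real d0 * (real q + 1))"
      using assms(1) by (intro mult_left_mono) auto
    \<comment> \<open>Uses \<open>a - 1 = (d0 - 1) / d0\<close>. The action is split as
      \<open>x + a * y = (x + y) + (a - 1) * y\<close>, where \<open>x + y\<close> is fixed.\<close>
    then have "(a - 1) * real y \<le> (real d0 - 1) * (real q + 1) / 2"
      unfolding assms(2) using pos by (simp add: field_simps)
    \<comment> \<open>The hypothesis is scaled by \<open>d0\<close> because the ellipsoid action
      equals \<open>d0 * p * c\<close>.\<close>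
    moreover have "real d0 * (real q * a + real p
        - (real q - 3) * (real d0 - 1) / (2 * real d0)) < real d0 * (real p * c)"
      using assms(8) pos by (intro mult_strict_left_mono) auto
    moreover have "real d0 * (real q * a + real p - (real q - 3) * (real d0 - 1) / (2 * real d0))
        = real q * (2 * real d0 - 1) + real d0 * real p - (real q - 3) * (real d0 - 1) / 2"
    proof -
      have "real d0 * a = 2 * real d0 - 1"
        using assms(2) pos by simp
      moreover have "real d0 * ((real q - 3) * (real d0 - 1) / (2 * real d0))
          = (real q - 3) * (real d0 - 1) / 2"
        using pos by simp
      moreover have "real d0 * (real q * a + real p - z)
          = real q * (real d0 * a) + real d0 * real p - real d0 * z" for z
        by (simp add: algebra_simps)
      ultimately show ?thesis
        by (simp only:)
    qed
    ultimately have "(a - 1) * real y \<le> (real d0 - 1) * (real q + 1) / 2"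
      and "real q * (2 * real d0 - 1) + real d0 * real p - (real q - 3) * (real d0 - 1) / 2
        < real d0 * (real p * c)"
      by simp_all
    \<comment> \<open>The upper bound for \<open>x + a * y\<close> and the scaled left side of the
      hypothesis coincide: both are \<open>d0 * (p + q) + (d0 - 1) * (q + 3) / 2\<close>.\<close>
    then have "real x + a * real y \<le> real d0 * real p * c"
      using sum by (simp add: field_simps)
    then show ?thesis
      by (simp add: polydisk_action_def xg yg E(8)[OF assms(7)] mult.commute)
  qed
  ultimately show ?thesis
    using E by (intro exI[of _ \<Lambda>]) (simp add: gen_le_def ECH_index_def algebra_simps)
qed

end
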